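(* Let $K$ be a field of characteristic $2$ and let $L_K$ be the Lorentz type algebra over $K$. Then $L_K$ is not simple: it has a three-dimensional ideal $I$ which is both a minimal ideal and a maximal ideal, satisfies $[I,I]=0$, and is such that $L_K/I\cong\mathfrak o(3;K)$, which is a simple Lie algebra. The ideal $I$ with these properties is unique.
   Context: For a commutative unital ring $R$, the Lorentz type algebra $L_R$ is the Lie $R$-algebra which is free as an $R$-module with basis $b_1,\dots,b_6$ and whose (alternating) bracket is given by $[b_1,b_2]=b_4$, $[b_1,b_3]=b_5$, $[b_1,b_4]=b_2$, $[b_1,b_5]=b_3$, $[b_1,b_6]=0$, $[b_2,b_3]=b_6$, $[b_2,b_4]=-b_1$, $[b_2,b_5]=0$, $[b_2,b_6]=b_3$, $[b_3,b_4]=0$, $[b_3,b_5]=-b_1$, $[b_3,b_6]=-b_2$, $[b_4,b_5]=-b_6$, $[b_4,b_6]=b_5$, $[b_5,b_6]=-b_4$. $\mathfrak o(3;R)$ is the Lie $R$-algebra free as an $R$-module on the basis $c_{12}=e_{12}-e_{21}$, $c_{13}=e_{13}-e_{31}$, $c_{23}=e_{23}-e_{32}$ with alternating bracket $[c_{12},c_{13}]=-c_{23}$, $[c_{12},c_{23}]=c_{13}$, $[c_{13},c_{23}]=-c_{12}$. A minimal ideal is a nonzero ideal minimal among nonzero ideals; a maximal ideal is a proper ideal maximal among proper ideals. *)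

theory Defs
  imports "Jordan_Normal_Form.VS_Connect" "HOL-Algebra.AbelCoset"
begin

section \<open>Lie algebras with explicit carriers\<close>

text \<open>The \<open>mult\<close> and \<open>one\<close> fields inherited from \<open>module\<close> are irrelevant, as they are for modules.\<close>

record ('a, 'b) lie_alg = "('a, 'b) module" +
  lie_bracket :: "'b \<Rightarrow> 'b \<Rightarrow> 'b"

locale lie_algebra = Module.module R L
  for R :: "('a, 'c) ring_scheme" and L :: "('a, 'b, 'd) lie_alg_scheme" (structure) +
  assumes bracket_closed [simp, intro]:
      "x \<in> carrier L \<Longrightarrow> y \<in> carrier L \<Longrightarrow> lie_bracket L x y \<in> carrier L"
    and bracket_add_left:
      "x \<in> carrier L \<Longrightarrow> y \<in> carrier L \<Longrightarrow> z \<in> carrier L \<Longrightarrow>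
        lie_bracket L (x \<oplus> y) z = lie_bracket L x z \<oplus> lie_bracket L y z"
    and bracket_add_right:
      "x \<in> carrier L \<Longrightarrow> y \<in> carrier L \<Longrightarrow> z \<in> carrier L \<Longrightarrow>
        lie_bracket L x (y \<oplus> z) = lie_bracket L x y \<oplus> lie_bracket L x z"
    and bracket_smult_left:
      "a \<in> carrier R \<Longrightarrow> x \<in> carrier L \<Longrightarrow> y \<in> carrier L \<Longrightarrow>
        lie_bracket L (a \<odot> x) y = a \<odot> lie_bracket L x y"
    and bracket_smult_right:
      "a \<in> carrier R \<Longrightarrow> x \<in> carrier L \<Longrightarrow> y \<in> carrier L \<Longrightarrow>
        lie_bracket L x (a \<odot> y) = a \<odot> lie_bracket L x y"
    and bracket_alternating: "x \<in> carrier L \<Longrightarrow> lie_bracket L x x = \<zero>"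
    and jacobi:
      "x \<in> carrier L \<Longrightarrow> y \<in> carrier L \<Longrightarrow> z \<in> carrier L \<Longrightarrow>
        lie_bracket L x (lie_bracket L y z) \<oplus> lie_bracket L y (lie_bracket L z x)
          \<oplus> lie_bracket L z (lie_bracket L x y) = \<zero>"

definition lie_ideal ::
  "('a, 'c) ring_scheme \<Rightarrow> 'b set \<Rightarrow> ('a, 'b, 'd) lie_alg_scheme \<Rightarrow> bool" where
  "lie_ideal R I L \<longleftrightarrow>
     LinearCombinations.submodule R I L \<and> (\<forall>x\<in>carrier L. \<forall>y\<in>I. lie_bracket L x y \<in> I)"

definition minimal_lie_ideal ::
  "('a, 'c) ring_scheme \<Rightarrow> 'b set \<Rightarrow> ('a, 'b, 'd) lie_alg_scheme \<Rightarrow> bool" where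
  "minimal_lie_ideal R I L \<longleftrightarrow> minimal I (\<lambda>J. lie_ideal R J L \<and> J \<noteq> {\<zero>\<^bsub>L\<^esub>})"

definition maximal_lie_ideal ::
  "('a, 'c) ring_scheme \<Rightarrow> 'b set \<Rightarrow> ('a, 'b, 'd) lie_alg_scheme \<Rightarrow> bool" where
  "maximal_lie_ideal R I L \<longleftrightarrow> maximal I (\<lambda>J. lie_ideal R J L \<and> J \<noteq> carrier L)"

definition simple_lie_algebra ::
  "('a, 'c) ring_scheme \<Rightarrow> ('a, 'b, 'd) lie_alg_scheme \<Rightarrow> bool" where
  "simple_lie_algebra R L \<longleftrightarrow>
     lie_algebra R L \<and>
     (\<exists>x\<in>carrier L. \<exists>y\<in>carrier L. lie_bracket L x y \<noteq> \<zero>\<^bsub>L\<^esub>) \<and>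
     (\<forall>I. lie_ideal R I L \<longrightarrow> I = {\<zero>\<^bsub>L\<^esub>} \<or> I = carrier L)"

text \<open>The product \<open>[A, B]\<close> of two submodules is the submodule spanned by all brackets.\<close>

definition lie_product ::
  "('a, 'c) ring_scheme \<Rightarrow> ('a, 'b, 'd) lie_alg_scheme \<Rightarrow> 'b set \<Rightarrow> 'b set \<Rightarrow> 'b set" where
  "lie_product R L A B = LinearCombinations.module.span R L {lie_bracket L x y | x y. x \<in> A \<and> y \<in> B}"

definition lie_quotient ::
  "('a, 'b, 'd) lie_alg_scheme \<Rightarrow> 'b set \<Rightarrow> ('a, 'b set) lie_alg" where
  "lie_quotient L I =
     \<lparr>carrier = a_rcosets\<^bsub>L\<^esub> I, mult = undefined, one = undefined, zero = I, add = set_add L,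
      smult = (\<lambda>a X. \<Union>x\<in>X. I +>\<^bsub>L\<^esub> (a \<odot>\<^bsub>L\<^esub> x)),
      lie_bracket = (\<lambda>X Y. \<Union>x\<in>X. \<Union>y\<in>Y. I +>\<^bsub>L\<^esub> (lie_bracket L x y))\<rparr>"

definition lie_isomorphic ::
  "('a, 'c) ring_scheme \<Rightarrow> ('a, 'b, 'd) lie_alg_scheme \<Rightarrow> ('a, 'e, 'f) lie_alg_scheme \<Rightarrow> bool" where
  "lie_isomorphic R L M \<longleftrightarrow>
     (\<exists>f\<in>LinearCombinations.module_hom R L M. bij_betw f (carrier L) (carrier M) \<and>
        (\<forall>x\<in>carrier L. \<forall>y\<in>carrier L. f (lie_bracket L x y) = lie_bracket M (f x) (f y)))"


section \<open>The Lorentz type algebra\<close>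

text \<open>Vectors are indexed from 0, so \<open>lorentz_basis i\<close> is \<open>b\<^sub>i\<close> for \<open>i = 1, \<dots>, 6\<close>.\<close>

definition lorentz_basis :: "nat \<Rightarrow> 'a :: comm_ring_1 vec" where
  "lorentz_basis i = unit_vec 6 (i - 1)"

text \<open>The alternating bilinear extension of the table of brackets \<open>[b\<^sub>i, b\<^sub>j]\<close>, \<open>i < j\<close>:
  \<open>p i j\<close> is the coefficient of \<open>[b\<^sub>i, b\<^sub>j]\<close> in \<open>[x, y]\<close>.\<close>

definition lorentz_bracket :: "'a :: comm_ring_1 vec \<Rightarrow> 'a vec \<Rightarrow> 'a vec" where
  "lorentz_bracket x y =
    (let p = (\<lambda>i j. x $ (i - 1) * y $ (j - 1) - x $ (j - 1) * y $ (i - 1));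
         b = lorentz_basis
     in p 1 2 \<cdot>\<^sub>v b 4 + p 1 3 \<cdot>\<^sub>v b 5 + p 1 4 \<cdot>\<^sub>v b 2 + p 1 5 \<cdot>\<^sub>v b 3
        + p 2 3 \<cdot>\<^sub>v b 6 - p 2 4 \<cdot>\<^sub>v b 1 + p 2 6 \<cdot>\<^sub>v b 3
        - p 3 5 \<cdot>\<^sub>v b 1 - p 3 6 \<cdot>\<^sub>v b 2
        - p 4 5 \<cdot>\<^sub>v b 6 + p 4 6 \<cdot>\<^sub>v b 5
        - p 5 6 \<cdot>\<^sub>v b 4)"

definition lorentz_algebra :: "'a :: comm_ring_1 itself \<Rightarrow> ('a, 'a vec) lie_alg" where
  "lorentz_algebra ty =
     \<lparr>carrier = carrier_vec 6, mult = undefined, one = undefined, zero = 0\<^sub>v 6, add = (+),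
      smult = (\<cdot>\<^sub>v), lie_bracket = lorentz_bracket\<rparr>"


lemma lorentz_algebra_simps [simp]:
  "carrier (lorentz_algebra ty) = carrier_vec 6"
  "\<zero>\<^bsub>lorentz_algebra ty\<^esub> = 0\<^sub>v 6"
  "add (lorentz_algebra ty) = (+)"
  "smult (lorentz_algebra ty) = (\<cdot>\<^sub>v)"
  "lie_bracket (lorentz_algebra ty) = lorentz_bracket"
  by (simp_all add: lorentz_algebra_def)

lemma lorentz_bracket_table:
  defines "b \<equiv> (lorentz_basis :: nat \<Rightarrow> 'a :: comm_ring_1 vec)"
  shows "lorentz_bracket (b 1) (b 2) = b 4" "lorentz_bracket (b 1) (b 3) = b 5"
    "lorentz_bracket (b 1) (b 4) = b 2" "lorentz_bracket (b 1) (b 5) = b 3"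
    "lorentz_bracket (b 1) (b 6) = 0\<^sub>v 6" "lorentz_bracket (b 2) (b 3) = b 6"
    "lorentz_bracket (b 2) (b 4) = - b 1" "lorentz_bracket (b 2) (b 5) = 0\<^sub>v 6"
    "lorentz_bracket (b 2) (b 6) = b 3" "lorentz_bracket (b 3) (b 4) = 0\<^sub>v 6"
    "lorentz_bracket (b 3) (b 5) = - b 1" "lorentz_bracket (b 3) (b 6) = - b 2"
    "lorentz_bracket (b 4) (b 5) = - b 6" "lorentz_bracket (b 4) (b 6) = b 5"
    "lorentz_bracket (b 5) (b 6) = - b 4"
  by (auto simp: b_def lorentz_bracket_def lorentz_basis_def Let_def)

lemma lorentz_bracket_carrier [simp]: "lorentz_bracket x y \<in> carrier_vec 6"
  by (simp add: lorentz_bracket_def lorentz_basis_def Let_def)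

lemma dim_lorentz_bracket [simp]: "dim_vec (lorentz_bracket x y) = 6"
  by (rule carrier_vecD) simp

lemma lorentz_bracket_index:
  "lorentz_bracket x y $ 0 = - (x$1 * y$3 - x$3 * y$1) - (x$2 * y$4 - x$4 * y$2)"
  "lorentz_bracket x y $ Suc 0 = x$0 * y$3 - x$3 * y$0 - (x$2 * y$5 - x$5 * y$2)"
  "lorentz_bracket x y $ 2 = x$0 * y$4 - x$4 * y$0 + (x$1 * y$5 - x$5 * y$1)"
  "lorentz_bracket x y $ 3 = x$0 * y$1 - x$1 * y$0 - (x$4 * y$5 - x$5 * y$4)"
  "lorentz_bracket x y $ 4 = x$0 * y$2 - x$2 * y$0 + (x$3 * y$5 - x$5 * y$3)"
  "lorentz_bracket x y $ 5 = x$1 * y$2 - x$2 * y$1 - (x$3 * y$4 - x$4 * y$3)"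
  by (simp_all add: lorentz_bracket_def lorentz_basis_def Let_def)

lemma vec6_eqI:
  assumes "x \<in> carrier_vec 6" "y \<in> carrier_vec 6"
    and "x $ 0 = y $ 0" "x $ Suc 0 = y $ Suc 0" "x $ 2 = y $ 2" "x $ 3 = y $ 3" "x $ 4 = y $ 4" "x $ 5 = y $ 5"
  shows "x = y"
proof (rule eq_vecI)
  fix i assume "i < dim_vec y"
  then have "i = 0 \<or> i = Suc 0 \<or> i = 2 \<or> i = 3 \<or> i = 4 \<or> i = 5"
    using assms(2) by auto
  then show "x $ i = y $ i" using assms by auto
qed (use assms in auto)

lemma lie_algebra_lorentz: "lie_algebra class_ring (lorentz_algebra TYPE('a :: comm_ring_1))"
proof -
  have ab: "abelian_group (lorentz_algebra TYPE('a))"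
    by (rule abelian_groupI) (auto intro!: bexI[of _ "- _"])
  have "Module.module class_ring (lorentz_algebra TYPE('a))"
    by (rule moduleI[OF class_cring.is_cring ab])
      (auto simp: add_smult_distrib_vec smult_add_distrib_vec smult_smult_assoc)
  then show ?thesis
  proof (rule lie_algebra.intro, unfold_locales)
  qed (auto intro!: vec6_eqI simp: lorentz_bracket_index algebra_simps)
qed


section \<open>The algebra \<open>o(3; R)\<close>\<close>

text \<open>\<open>o3_basis i j\<close> is \<open>c\<^sub>i\<^sub>j = e\<^sub>i\<^sub>j - e\<^sub>j\<^sub>i\<close> with the usual 1-based indices.\<close>

definition matrix_unit :: "nat \<Rightarrow> nat \<Rightarrow> nat \<Rightarrow> 'a :: comm_ring_1 mat" where
  "matrix_unit n i j = mat n n (\<lambda>(k, l). if k = i - 1 \<and> l = j - 1 then 1 else 0)"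

definition o3_basis :: "nat \<Rightarrow> nat \<Rightarrow> 'a :: comm_ring_1 mat" where
  "o3_basis i j = matrix_unit 3 i j - matrix_unit 3 j i"

definition o3 :: "'a :: comm_ring_1 itself \<Rightarrow> ('a, 'a mat) lie_alg" where
  "o3 ty =
     \<lparr>carrier = LinearCombinations.module.span class_ring (module_mat ty 3 3)
                  {o3_basis 1 2, o3_basis 1 3, o3_basis 2 3},
      mult = undefined, one = undefined, zero = 0\<^sub>m 3 3, add = (+), smult = (\<cdot>\<^sub>m),
      lie_bracket = (\<lambda>A B. A * B - B * A)\<rparr>"

lemma o3_simps [simp]:
  "\<zero>\<^bsub>o3 ty\<^esub> = 0\<^sub>m 3 3"
  "add (o3 ty) = (+)"
  "smult (o3 ty) = (\<cdot>\<^sub>m)"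
  "lie_bracket (o3 ty) = (\<lambda>A B. A * B - B * A)"
  by (simp_all add: o3_def)

lemma o3_bracket_table:
  defines "c \<equiv> (o3_basis :: nat \<Rightarrow> nat \<Rightarrow> 'a :: comm_ring_1 mat)"
    and "br \<equiv> lie_bracket (o3 TYPE('a))"
  shows "br (c 1 2) (c 1 3) = - c 2 3" "br (c 1 2) (c 2 3) = c 1 3" "br (c 1 3) (c 2 3) = - c 1 2"
  by (auto simp: c_def br_def o3_basis_def matrix_unit_def scalar_prod_def numeral_3_eq_3)

end

theory Submission
  imports Defs
begin

text \<open>In characteristic 2 signs disappear, and \<open>b\<^sub>4 \<mapsto> c\<^sub>1\<^sub>2\<close>, \<open>b\<^sub>5 \<mapsto> c\<^sub>1\<^sub>3\<close>, \<open>b\<^sub>6 \<mapsto> c\<^sub>2\<^sub>3\<close>,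
  \<open>b\<^sub>3 \<mapsto> c\<^sub>1\<^sub>2\<close>, \<open>b\<^sub>2 \<mapsto> c\<^sub>1\<^sub>3\<close>, \<open>b\<^sub>1 \<mapsto> c\<^sub>2\<^sub>3\<close> defines an epimorphism \<open>\<phi>\<close> of the
  Lorentz type algebra \<open>L\<close> onto \<open>o(3)\<close>. Its kernel \<open>I\<close>, spanned by \<open>b\<^sub>3 + b\<^sub>4\<close>, \<open>b\<^sub>2 + b\<^sub>5\<close>, \<open>b\<^sub>1 + b\<^sub>6\<close>,
  is the image of an injective linear map \<open>\<iota>\<close> from \<open>o(3)\<close> to \<open>L\<close> with \<open>[x, \<iota> A] = \<iota> [\<phi> x, A]\<close>
  and \<open>\<phi> \<circ> \<iota> = 0\<close>; so \<open>I\<close> is abelian and isomorphic to the adjoint module of \<open>o(3)\<close>.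
  Since \<open>o(3)\<close> is simple, \<open>I\<close> is both maximal and minimal. Another minimal ideal \<open>J\<close> would
  contain some \<open>x\<close> with \<open>\<phi> x \<noteq> 0\<close>; as \<open>o(3)\<close> has trivial centre, some \<open>[x, \<iota> A] = \<iota> [\<phi> x, A]\<close>
  is a nonzero element of \<open>I \<inter> J\<close>, which forces \<open>I = J\<close>.\<close>

section \<open>Epimorphisms of Lie algebras\<close>

lemma (in lie_algebra) bracket_zero_right: "x \<in> carrier L \<Longrightarrow> lie_bracket L x \<zero> = \<zero>"
  using bracket_smult_right[of "\<zero>\<^bsub>R\<^esub>" x \<zero>] by simp

lemma (in lie_algebra) bracket_zero_left: "x \<in> carrier L \<Longrightarrow> lie_bracket L \<zero> x = \<zero>"
  using bracket_smult_left[of "\<zero>\<^bsub>R\<^esub>" \<zero> x] by simp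

lemma (in lie_algebra) bracket_antisym:
  assumes x: "x \<in> carrier L" and y: "y \<in> carrier L"
  shows "lie_bracket L x y = \<ominus> lie_bracket L y x"
proof -
  have "lie_bracket L (x \<oplus> y) (x \<oplus> y)
      = (lie_bracket L x x \<oplus> lie_bracket L y x) \<oplus> (lie_bracket L x y \<oplus> lie_bracket L y y)"
    using x y by (simp only: bracket_add_left bracket_add_right M.a_closed)
  then have "lie_bracket L x y \<oplus> lie_bracket L y x = \<zero>"
    using x y by (simp add: bracket_alternating M.a_comm)
  then show ?thesis
    using x y by (intro M.minus_equality[symmetric]) auto
qed

text \<open>The centre \<open>?Z\<close> is an ideal, and a nonzero bracket keeps it from being
  everything, so simplicity forces it to be zero.\<close>

lemma (in lie_algebra) simple_centerless:
  assumes simple: "simple_lie_algebra R L"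
    and x: "x \<in> carrier L" "x \<noteq> \<zero>"
  obtains y where "y \<in> carrier L" "lie_bracket L x y \<noteq> \<zero>"
proof -
  let ?Z = "{z \<in> carrier L. \<forall>y\<in>carrier L. lie_bracket L z y = \<zero>}"
  have "lie_bracket L y z = \<zero>" if "y \<in> carrier L" "z \<in> ?Z" for y z
    using that bracket_antisym[of y z] by auto
  then have "lie_ideal R ?Z L"
    unfolding lie_ideal_def LinearCombinations.submodule_def
    using module_axioms
    by (simp add: bracket_add_left bracket_smult_left bracket_zero_left subset_eq)
  then have "?Z = {\<zero>} \<or> ?Z = carrier L"
    using simple unfolding simple_lie_algebra_def by blast
  moreover have "?Z \<noteq> carrier L"
    using simple unfolding simple_lie_algebra_def by blast
  ultimately show ?thesis
    using x that by blast
qed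

lemma lie_ideal_inter:
  "lie_ideal R I L \<Longrightarrow> lie_ideal R J L \<Longrightarrow> lie_ideal R (I \<inter> J) L"
  unfolding lie_ideal_def LinearCombinations.submodule_def by auto

lemma lie_ideal_subset: "lie_ideal R I L \<Longrightarrow> I \<subseteq> carrier L"
  unfolding lie_ideal_def LinearCombinations.submodule_def by auto

section \<open>Ideals, kernels and quotients under an epimorphism\<close>

locale lie_epimorphism = dom: lie_algebra R L + cod: lie_algebra R M
  for R :: "('a, 'c) ring_scheme" and L :: "('a, 'b, 'd) lie_alg_scheme"
    and M :: "('a, 'e, 'g) lie_alg_scheme" +
  fixes f :: "'b \<Rightarrow> 'e"
  assumes hom: "f \<in> LinearCombinations.module_hom R L M"
    and hom_bracket: "x \<in> carrier L \<Longrightarrow> y \<in> carrier L \<Longrightarrow>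
      f (lie_bracket L x y) = lie_bracket M (f x) (f y)"
    and surj: "f ` carrier L = carrier M"
begin

sublocale mod_hom R L M f
  by unfold_locales (rule hom)

lemma ker_ideal: "lie_ideal R ker L"
  unfolding lie_ideal_def
  using ker_is_submodule by (auto simp: ker_def hom_bracket cod.bracket_zero_right)

text \<open>Surjectivity lifts an arbitrary element of the target to the source, where J absorbs
  brackets.\<close>

lemma image_ideal:
  assumes "lie_ideal R J L"
  shows "lie_ideal R (f ` J) M"
proof -
  have J: "J \<subseteq> carrier L" "\<zero>\<^bsub>L\<^esub> \<in> J"
    and cl: "\<And>x y. x \<in> J \<Longrightarrow> y \<in> J \<Longrightarrow> x \<oplus>\<^bsub>L\<^esub> y \<in> J"
      "\<And>a x. a \<in> carrier R \<Longrightarrow> x \<in> J \<Longrightarrow> a \<odot>\<^bsub>L\<^esub> x \<in> J"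
      "\<And>x y. x \<in> carrier L \<Longrightarrow> y \<in> J \<Longrightarrow> lie_bracket L x y \<in> J"
    using assms unfolding lie_ideal_def LinearCombinations.submodule_def by auto
  have "LinearCombinations.submodule R (f ` J) M"
  proof (rule LinearCombinations.submodule.intro)
    show "\<zero>\<^bsub>M\<^esub> \<in> f ` J" using J by (metis f0_is_0 imageI)
    show "v \<oplus>\<^bsub>M\<^esub> w \<in> f ` J" if "v \<in> f ` J" "w \<in> f ` J" for v w
      using that J cl(1) by (auto simp flip: f_add simp: subset_iff)
    show "c \<odot>\<^bsub>M\<^esub> v \<in> f ` J" if "c \<in> carrier R" "v \<in> f ` J" for c v
      using that J cl(2) by (auto simp flip: f_smult simp: subset_iff)
  qed (use J in \<open>auto intro: cod.module_axioms\<close>)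
  moreover have "lie_bracket M x y \<in> f ` J" if x: "x \<in> carrier M" and y: "y \<in> f ` J" for x y
  proof -
    obtain x' y' where "x' \<in> carrier L" "x = f x'" "y' \<in> J" "y = f y'"
      using x y surj by blast
    then show ?thesis
      using cl(3) J by (auto simp flip: hom_bracket simp: subset_iff)
  qed
  ultimately show ?thesis
    unfolding lie_ideal_def by blast
qed

text \<open>An ideal J above the kernel has image zero or everything. A zero image puts J inside the
  kernel; a full image makes J everything, because elements with equal image differ by an element of
  \<open>ker\<close>, hence of J.\<close>

lemma ker_maximal:
  assumes simple: "simple_lie_algebra R M"
  shows "maximal_lie_ideal R ker L"
proof -
  obtain x y where "x \<in> carrier M" "y \<in> carrier M" "lie_bracket M x y \<noteq> \<zero>\<^bsub>M\<^esub>"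
    using simple unfolding simple_lie_algebra_def by blast
  then have "carrier M \<noteq> {\<zero>\<^bsub>M\<^esub>}"
    using cod.bracket_closed by blast
  then have "ker \<noteq> carrier L"
    using surj f_ker by auto
  moreover have "J = ker" if J: "ker \<subseteq> J" "lie_ideal R J L" "J \<noteq> carrier L" for J
  proof -
    note sub = lie_ideal_subset[OF J(2)]
    have "f ` J = {\<zero>\<^bsub>M\<^esub>} \<or> f ` J = carrier M"
      using simple image_ideal[OF J(2)] unfolding simple_lie_algebra_def by blast
    moreover have "f ` J \<noteq> carrier M"
    proof
      assume full: "f ` J = carrier M"
      have "x \<in> J" if x: "x \<in> carrier L" for x
      proof -
        obtain j where j: "j \<in> J" "f x = f j"
          using full f_im[OF x] by auto
        then have jL: "j \<in> carrier L" using sub by blast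
        have "x \<ominus>\<^bsub>L\<^esub> j \<in> ker"
          using x jL j by (simp add: ker_def cod.M.r_neg a_minus_def)
        then have "x \<ominus>\<^bsub>L\<^esub> j \<in> J" using J(1) by blast
        then have "(x \<ominus>\<^bsub>L\<^esub> j) \<oplus>\<^bsub>L\<^esub> j \<in> J"
          using J(2) j(1) unfolding lie_ideal_def LinearCombinations.submodule_def by blast
        then show ?thesis
          using x jL by (simp add: a_minus_def dom.M.a_assoc dom.M.l_neg)
      qed
      then show False using J(3) sub by blast
    qed
    ultimately have "J \<subseteq> ker" using sub by (auto simp: ker_def)
    then show ?thesis using J(1) by blast
  qed
  ultimately show ?thesis
    unfolding maximal_lie_ideal_def maximal_def using ker_ideal by blast
qed

text \<open>Cosets of the kernel are fibres, so the coset operations of \<open>lie_quotient\<close>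
  can be computed through f.\<close>

lemma rcoset_ker:
  assumes x: "x \<in> carrier L"
  shows "ker +>\<^bsub>L\<^esub> x = {z \<in> carrier L. f z = f x}"
proof (intro equalityI subsetI)
  fix z assume "z \<in> {z \<in> carrier L. f z = f x}"
  then have z: "z \<in> carrier L" "f z = f x" by auto
  have "z \<ominus>\<^bsub>L\<^esub> x \<in> ker"
    using x z by (simp add: ker_def cod.M.r_neg a_minus_def)
  moreover have "z = (z \<ominus>\<^bsub>L\<^esub> x) \<oplus>\<^bsub>L\<^esub> x"
    using x z by (simp add: a_minus_def dom.M.a_assoc dom.M.l_neg)
  ultimately show "z \<in> ker +>\<^bsub>L\<^esub> x"
    unfolding a_r_coset_def' by blast
qed (use x in \<open>auto simp: a_r_coset_def' ker_def\<close>)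

lemma quotient_ker_isomorphic: "lie_isomorphic R (lie_quotient L ker) M"
proof -
  let ?Q = "lie_quotient L ker"
  let ?g = "\<lambda>X. the_elem (f ` X)"
  define F where "F = (\<lambda>x. {z \<in> carrier L. f z = f x})"
  have carrier: "carrier ?Q = F ` carrier L"
    by (auto simp: lie_quotient_def A_RCOSETS_def' rcoset_ker F_def)
  have g: "?g X = y" if "f ` X = {y}" for X y
    using that by simp
  have fF: "f ` F x = {f x}" if "x \<in> carrier L" for x
    using that by (auto simp: F_def)
  have gF: "?g (F x) = f x" if "x \<in> carrier L" for x
    using that by (rule g[OF fF])
  have add: "f ` (F x \<oplus>\<^bsub>?Q\<^esub> F y) = {f x \<oplus>\<^bsub>M\<^esub> f y}" if "x \<in> carrier L" "y \<in> carrier L" for x y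
    using that by (auto simp: F_def lie_quotient_def set_add_def' intro!: image_eqI[where x = "x \<oplus>\<^bsub>L\<^esub> y"])
  have smult: "f ` (a \<odot>\<^bsub>?Q\<^esub> F x) = {a \<odot>\<^bsub>M\<^esub> f x}" if "a \<in> carrier R" "x \<in> carrier L" for a x
    using that by (auto simp: F_def lie_quotient_def rcoset_ker intro!: image_eqI[where x = "a \<odot>\<^bsub>L\<^esub> x"])
  have bracket: "f ` lie_bracket ?Q (F x) (F y) = {lie_bracket M (f x) (f y)}"
    if "x \<in> carrier L" "y \<in> carrier L" for x y
    using that by (auto simp: F_def lie_quotient_def rcoset_ker hom_bracket
        intro!: image_eqI[where x = "lie_bracket L x y"])
  have "?g \<in> LinearCombinations.module_hom R ?Q M"
    unfolding LinearCombinations.module_hom_def carrier by (auto simp: gF g[OF add] g[OF smult])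
  moreover have "bij_betw ?g (carrier ?Q) (carrier M)"
  proof (rule bij_betw_imageI)
    show "inj_on ?g (carrier ?Q)"
      unfolding carrier by (auto intro!: inj_onI simp: gF) (auto simp: F_def)
    show "?g ` carrier ?Q = carrier M"
      unfolding carrier image_image using surj gF by (simp cong: image_cong)
  qed
  moreover have "\<forall>X\<in>carrier ?Q. \<forall>Y\<in>carrier ?Q. ?g (lie_bracket ?Q X Y) = lie_bracket M (?g X) (?g Y)"
    unfolding carrier by (auto simp: gF g[OF bracket])
  ultimately show ?thesis
    unfolding lie_isomorphic_def by blast
qed

end

section \<open>Three-dimensional spaces\<close>

context Module.module
begin

lemma lincomb_three:
  assumes "u \<in> carrier M" "v \<in> carrier M" "w \<in> carrier M" "u \<noteq> v" "u \<noteq> w" "v \<noteq> w"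
    and "a \<in> {u, v, w} \<rightarrow> carrier R"
  shows "lincomb a {u, v, w} = a u \<odot>\<^bsub>M\<^esub> u \<oplus>\<^bsub>M\<^esub> (a v \<odot>\<^bsub>M\<^esub> v \<oplus>\<^bsub>M\<^esub> a w \<odot>\<^bsub>M\<^esub> w)"
  using assms unfolding lincomb_def by (simp add: Pi_iff)

lemma span_three:
  assumes "u \<in> carrier M" "v \<in> carrier M" "w \<in> carrier M" "u \<noteq> v" "u \<noteq> w" "v \<noteq> w"
  shows "span {u, v, w} = {a \<odot>\<^bsub>M\<^esub> u \<oplus>\<^bsub>M\<^esub> (b \<odot>\<^bsub>M\<^esub> v \<oplus>\<^bsub>M\<^esub> c \<odot>\<^bsub>M\<^esub> w) | a b c.
    a \<in> carrier R \<and> b \<in> carrier R \<and> c \<in> carrier R}" (is "_ = ?S")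
proof -
  have "span {u, v, w} = {lincomb a {u, v, w} | a. a \<in> {u, v, w} \<rightarrow> carrier R}"
    using assms by (intro finite_span) auto
  also have "\<dots> = ?S"
  proof (intro equalityI subsetI)
    fix x assume "x \<in> ?S"
    then obtain a b c where x: "x = a \<odot>\<^bsub>M\<^esub> u \<oplus>\<^bsub>M\<^esub> (b \<odot>\<^bsub>M\<^esub> v \<oplus>\<^bsub>M\<^esub> c \<odot>\<^bsub>M\<^esub> w)"
      and abc: "a \<in> carrier R" "b \<in> carrier R" "c \<in> carrier R"
      by blast
    let ?a = "\<lambda>z. if z = u then a else if z = v then b else c"
    have "?a \<in> {u, v, w} \<rightarrow> carrier R" using abc by auto
    moreover from this have "x = lincomb ?a {u, v, w}"
      using assms by (subst lincomb_three) (auto simp: x)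
    ultimately show "x \<in> {lincomb a {u, v, w} | a. a \<in> {u, v, w} \<rightarrow> carrier R}" by blast
  next
    fix x assume "x \<in> {lincomb a {u, v, w} | a. a \<in> {u, v, w} \<rightarrow> carrier R}"
    then obtain a where a: "x = lincomb a {u, v, w}" "a \<in> {u, v, w} \<rightarrow> carrier R" by blast
    have "x = a u \<odot>\<^bsub>M\<^esub> u \<oplus>\<^bsub>M\<^esub> (a v \<odot>\<^bsub>M\<^esub> v \<oplus>\<^bsub>M\<^esub> a w \<odot>\<^bsub>M\<^esub> w)"
      using lincomb_three[OF assms a(2)] a(1) by simp
    then show "x \<in> ?S" using a(2) by auto
  qed
  finally show ?thesis .
qed

end

text \<open>A coordinate criterion: \<open>gen\<close> and \<open>indep\<close> say that u, v, w
  form a basis, and distinctness makes its cardinality 3.\<close>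

lemma (in vectorspace) dim_eq_threeI:
  assumes carr: "u \<in> carrier V" "v \<in> carrier V" "w \<in> carrier V"
    and dist: "u \<noteq> v" "u \<noteq> w" "v \<noteq> w"
    and gen: "\<And>x. x \<in> carrier V \<Longrightarrow> \<exists>a\<in>carrier K. \<exists>b\<in>carrier K. \<exists>c\<in>carrier K.
      x = a \<odot>\<^bsub>V\<^esub> u \<oplus>\<^bsub>V\<^esub> (b \<odot>\<^bsub>V\<^esub> v \<oplus>\<^bsub>V\<^esub> c \<odot>\<^bsub>V\<^esub> w)"
    and indep: "\<And>a b c. a \<in> carrier K \<Longrightarrow> b \<in> carrier K \<Longrightarrow> c \<in> carrier K \<Longrightarrow>
      a \<odot>\<^bsub>V\<^esub> u \<oplus>\<^bsub>V\<^esub> (b \<odot>\<^bsub>V\<^esub> v \<oplus>\<^bsub>V\<^esub> c \<odot>\<^bsub>V\<^esub> w) = \<zero>\<^bsub>V\<^esub> \<Longrightarrow> a = \<zero>\<^bsub>K\<^esub> \<and> b = \<zero>\<^bsub>K\<^esub> \<and> c = \<zero>\<^bsub>K\<^esub>"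
  shows "dim = 3"
proof -
  have "lin_indpt {u, v, w}"
  proof (rule finite_lin_indpt2)
    fix a assume a: "a \<in> {u, v, w} \<rightarrow> carrier K" "lincomb a {u, v, w} = \<zero>\<^bsub>V\<^esub>"
    then show "\<forall>x\<in>{u, v, w}. a x = \<zero>\<^bsub>K\<^esub>"
      using indep[of "a u" "a v" "a w"] lincomb_three[OF carr dist a(1)] by (auto simp: Pi_iff)
  qed (use carr in auto)
  moreover have "gen_set {u, v, w}"
    using carr gen unfolding span_three[OF carr dist] by blast
  ultimately have "basis {u, v, w}"
    unfolding basis_def using carr by auto
  then have "dim = card {u, v, w}"
    by (intro dim_basis) auto
  then show ?thesis using dist by simp
qed

section \<open>The algebra \<open>o(3)\<close> over a field\<close>

text \<open>Coordinates on \<open>o3\<close>, which reduce all matrix computations to triples. The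
  sum is nested to the right so as to match \<open>span_three\<close>.\<close>

definition o3_elem :: "'a :: comm_ring_1 \<Rightarrow> 'a \<Rightarrow> 'a \<Rightarrow> 'a mat" where
  "o3_elem a b c = a \<cdot>\<^sub>m o3_basis 1 2 + (b \<cdot>\<^sub>m o3_basis 1 3 + c \<cdot>\<^sub>m o3_basis 2 3)"

lemma o3_basis_carrier [simp]: "o3_basis i j \<in> carrier_mat 3 3"
  by (simp add: o3_basis_def matrix_unit_def carrier_matI)

lemma o3_elem_index [simp]:
  "o3_elem a b c $$ (0, Suc 0) = a" "o3_elem a b c $$ (0, 2) = b" "o3_elem a b c $$ (Suc 0, 2) = c"
  by (simp_all add: o3_elem_def o3_basis_def matrix_unit_def)

lemma o3_elem_eq_iff [simp]:
  "o3_elem a b c = o3_elem a' b' c' \<longleftrightarrow> a = a' \<and> b = b' \<and> c = c'"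
  by (metis o3_elem_index)

lemma o3_elem_zero: "0\<^sub>m 3 3 = o3_elem 0 0 0"
  by (rule eq_matI) (auto simp: o3_elem_def o3_basis_def matrix_unit_def)

lemma o3_elem_add: "o3_elem a b c + o3_elem a' b' c' = o3_elem (a + a') (b + b') (c + c')"
  by (rule eq_matI) (auto simp: o3_elem_def o3_basis_def matrix_unit_def algebra_simps)

lemma o3_elem_smult: "k \<cdot>\<^sub>m o3_elem a b c = o3_elem (k * a) (k * b) (k * c)"
  by (rule eq_matI) (auto simp: o3_elem_def o3_basis_def matrix_unit_def algebra_simps)

text \<open>In coordinates the commutator is the negative of the cross product of the two
  triples.\<close>

lemma o3_elem_bracket:
  "o3_elem a b c * o3_elem a' b' c' - o3_elem a' b' c' * o3_elem a b c
    = o3_elem (c * b' - b * c') (a * c' - c * a') (b * a' - a * b')"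
  by (rule eq_matI)
    (auto simp: o3_elem_def o3_basis_def matrix_unit_def scalar_prod_def numeral_3_eq_3
      less_Suc_eq algebra_simps)

lemma o3_basis_elem:
  "o3_basis 1 2 = o3_elem 1 0 0" "o3_basis 1 3 = o3_elem 0 1 0" "o3_basis 2 3 = o3_elem 0 0 1"
  by (auto intro!: eq_matI simp: o3_elem_def o3_basis_def matrix_unit_def)

lemma carrier_o3: "carrier (o3 TYPE('k :: field)) = {o3_elem a b c | a b c. True}"
proof -
  interpret matrix_vs 3 3 "TYPE('k)" .
  have "(o3_basis 1 2 :: 'k mat) \<noteq> o3_basis 1 3" "(o3_basis 1 2 :: 'k mat) \<noteq> o3_basis 2 3"
    "(o3_basis 1 3 :: 'k mat) \<noteq> o3_basis 2 3"
    unfolding o3_basis_elem by simp_all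
  then show ?thesis
    unfolding o3_def partial_object.simps o3_elem_def by (subst span_three) auto
qed

lemma o3_elem_mem [simp]: "o3_elem a b c \<in> carrier (o3 TYPE('k :: field))"
  unfolding carrier_o3 by blast

lemma o3_cases:
  assumes "A \<in> carrier (o3 TYPE('k :: field))"
  obtains a b c where "A = o3_elem a b c"
  using assms unfolding carrier_o3 by blast

lemmas o3_elem_simps = o3_elem_zero o3_elem_add o3_elem_smult o3_elem_bracket

lemma lie_algebra_o3: "lie_algebra class_ring (o3 TYPE('k :: field))"
proof -
  have ab: "abelian_group (o3 TYPE('k))"
  proof (rule abelian_groupI)
    fix x assume "x \<in> carrier (o3 TYPE('k))"
    then obtain a b c where x: "x = o3_elem a b c" by (rule o3_cases)
    show "\<exists>y\<in>carrier (o3 TYPE('k)). y \<oplus>\<^bsub>o3 TYPE('k)\<^esub> x = \<zero>\<^bsub>o3 TYPE('k)\<^esub>"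
      by (rule bexI[of _ "o3_elem (- a) (- b) (- c)"]) (simp_all add: x o3_elem_simps)
  qed (auto elim!: o3_cases simp: o3_elem_simps algebra_simps)
  have "Module.module class_ring (o3 TYPE('k))"
    by (rule moduleI[OF class_cring.is_cring ab])
      (auto elim!: o3_cases simp: o3_elem_simps algebra_simps)
  then show ?thesis
  proof (rule lie_algebra.intro, unfold_locales)
  qed (auto elim!: o3_cases simp: o3_elem_simps algebra_simps)
qed

text \<open>The brackets of \<open>o3_elem a b c\<close> with two basis vectors isolate a single coordinate.\<close>

lemma simple_o3: "simple_lie_algebra class_ring (o3 TYPE('k :: field))"
proof -
  let ?M = "o3 TYPE('k)"
  have "J = {\<zero>\<^bsub>?M\<^esub>} \<or> J = carrier ?M" if "lie_ideal class_ring J ?M" for J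
  proof -
    have sub: "J \<subseteq> carrier ?M" and zero: "o3_elem 0 0 0 \<in> J"
      and add: "\<And>x y. x \<in> J \<Longrightarrow> y \<in> J \<Longrightarrow> x + y \<in> J"
      and smult: "\<And>a x. x \<in> J \<Longrightarrow> a \<cdot>\<^sub>m x \<in> J"
      and bracket: "\<And>x y. x \<in> carrier ?M \<Longrightarrow> y \<in> J \<Longrightarrow> x * y - y * x \<in> J"
      using that unfolding lie_ideal_def LinearCombinations.submodule_def
      by (auto simp: o3_elem_zero)
    have ad: "o3_elem (c * b' - b * c') (a * c' - c * a') (b * a' - a * b') \<in> J"
      if "o3_elem a' b' c' \<in> J" for a b c a' b' c'
      using bracket[OF _ that, of "o3_elem a b c"] by (simp add: o3_elem_bracket)
    \<comment> \<open>Bracketing with (0, 0, 1) turns (a, b, c) into (b, -a, 0), and then (1, 0, 0)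
      yields (0, 0, a). The next two facts use the analogous choices for b and c.\<close>
    have e3: "o3_elem 0 0 1 \<in> J" if "o3_elem a b c \<in> J" "a \<noteq> 0" for a b c
      using smult[OF ad[OF ad[OF that(1), where a = 0 and b = 0 and c = 1], where a = 1 and b = 0 and c = 0], of "1 / a"] that(2)
      by (simp add: o3_elem_smult)
    have e1: "o3_elem 1 0 0 \<in> J" if "o3_elem a b c \<in> J" "b \<noteq> 0" for a b c
      using smult[OF ad[OF ad[OF that(1), where a = 1 and b = 0 and c = 0], where a = 0 and b = 1 and c = 0], of "1 / b"] that(2)
      by (simp add: o3_elem_smult)
    have e2: "o3_elem 0 1 0 \<in> J" if "o3_elem a b c \<in> J" "c \<noteq> 0" for a b c
      using smult[OF ad[OF ad[OF that(1), where a = 0 and b = 1 and c = 0], where a = 0 and b = 0 and c = 1], of "1 / c"] that(2)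
      by (simp add: o3_elem_smult)
    show ?thesis
    proof (cases "J \<subseteq> {\<zero>\<^bsub>?M\<^esub>}")
      case True
      then show ?thesis using zero by (auto simp: o3_elem_zero)
    next
      case False
      then obtain x where x: "x \<in> J" "x \<noteq> o3_elem 0 0 0"
        by (auto simp: o3_elem_zero)
      then obtain a b c where "x = o3_elem a b c"
        using sub o3_cases by blast
      then have "o3_elem a b c \<in> J" "a \<noteq> 0 \<or> b \<noteq> 0 \<or> c \<noteq> 0"
        using x by auto
      \<comment> \<open>One nonzero coordinate gives one unit triple, and the units produce each
        other in a cycle: (1, 0, 0) gives (0, 0, 1), which gives (0, 1, 0), which gives (1, 0,
        0).\<close>
      then have units: "o3_elem 1 0 0 \<in> J" "o3_elem 0 1 0 \<in> J" "o3_elem 0 0 1 \<in> J"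
        using e1 e2 e3 zero_neq_one by metis+
      have "o3_elem a b c \<in> J" for a b c
        using add[OF smult[OF units(1), of a] add[OF smult[OF units(2), of b] smult[OF units(3), of c]]]
        by (simp add: o3_elem_smult o3_elem_add)
      then show ?thesis using sub by (auto simp: carrier_o3)
    qed
  qed
  moreover have "lie_bracket ?M (o3_elem 1 0 0) (o3_elem 0 1 0) \<noteq> \<zero>\<^bsub>?M\<^esub>"
    by (simp add: o3_elem_bracket o3_elem_zero)
  ultimately show ?thesis
    unfolding simple_lie_algebra_def using lie_algebra_o3 o3_elem_mem by blast
qed

section \<open>The ideal of the Lorentz type algebra in characteristic 2\<close>

text \<open>The map \<phi>. Indices start at 0, so \<open>x $ 3 + x $ 2\<close> adds the
  coefficients of \<open>b\<^sub>4\<close> and \<open>b\<^sub>3\<close>.\<close>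

definition lorentz_to_o3 :: "'k :: field vec \<Rightarrow> 'k mat" where
  "lorentz_to_o3 x = o3_elem (x $ 3 + x $ 2) (x $ 4 + x $ 1) (x $ 5 + x $ 0)"

text \<open>The map \<iota>, sending \<open>c\<^sub>1\<^sub>2\<close>,
  \<open>c\<^sub>1\<^sub>3\<close>, \<open>c\<^sub>2\<^sub>3\<close> to
  \<open>b\<^sub>3 + b\<^sub>4\<close>, \<open>b\<^sub>2 + b\<^sub>5\<close>,
  \<open>b\<^sub>1 + b\<^sub>6\<close>. It reads the entries above the diagonal, which determine an
  element of \<open>o3\<close>.\<close>

definition o3_to_lorentz :: "'k :: field mat \<Rightarrow> 'k vec" where
  "o3_to_lorentz A =
    vec 6 ((!) [A $$ (1, 2), A $$ (0, 2), A $$ (0, 1), A $$ (0, 1), A $$ (0, 2), A $$ (1, 2)])"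

lemma o3_to_lorentz_carrier [simp]: "o3_to_lorentz A \<in> carrier_vec 6"
  by (rule carrier_vecI) (simp add: o3_to_lorentz_def)

lemma dim_o3_to_lorentz [simp]: "dim_vec (o3_to_lorentz A) = 6"
  by (rule carrier_vecD) simp

lemma o3_to_lorentz_index [simp]:
  "o3_to_lorentz (o3_elem a b c) $ 0 = c" "o3_to_lorentz (o3_elem a b c) $ Suc 0 = b"
  "o3_to_lorentz (o3_elem a b c) $ 2 = a" "o3_to_lorentz (o3_elem a b c) $ 3 = a"
  "o3_to_lorentz (o3_elem a b c) $ 4 = b" "o3_to_lorentz (o3_elem a b c) $ 5 = c"
  by (simp_all add: o3_to_lorentz_def)

lemma o3_to_lorentz_eq_iff [simp]:
  "o3_to_lorentz (o3_elem a b c) = o3_to_lorentz (o3_elem a' b' c')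
    \<longleftrightarrow> o3_elem a b c = o3_elem a' b' c'"
  by (metis o3_to_lorentz_index(1-3) o3_elem_eq_iff)

lemma o3_to_lorentz_zero: "o3_to_lorentz (o3_elem 0 0 0) = 0\<^sub>v 6"
  by (rule vec6_eqI) simp_all

lemma o3_to_lorentz_add:
  "o3_to_lorentz (o3_elem a b c + o3_elem a' b' c')
    = o3_to_lorentz (o3_elem a b c) + o3_to_lorentz (o3_elem a' b' c')"
  by (rule vec6_eqI) (simp_all add: o3_elem_add)

lemma o3_to_lorentz_smult:
  "o3_to_lorentz (k \<cdot>\<^sub>m o3_elem a b c) = k \<cdot>\<^sub>v o3_to_lorentz (o3_elem a b c)"
  by (rule vec6_eqI) (simp_all add: o3_elem_smult)

text \<open>Taken as the image of \<iota>, so that its elements carry \<open>o3\<close> coordinates;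
  \<open>ker_lorentz_to_o3\<close> identifies it with the kernel of \<phi> in characteristic
  2.\<close>

definition lorentz_ideal :: "'k :: field itself \<Rightarrow> 'k vec set" where
  "lorentz_ideal ty = o3_to_lorentz ` carrier (o3 ty)"

section \<open>The two maps and the kernel ideal in characteristic 2\<close>

context
  assumes char2: "CHAR('k :: field) = 2"
begin

lemma double_eq_0: "(x :: 'k) + x = 0"
  using minus_CHAR_2[OF char2, of x x] by simp

text \<open>In each of the three coordinates the same eight products occur on both sides up to sign,
  and signs vanish in characteristic 2.\<close>

lemma lorentz_to_o3_bracket:
  "lorentz_to_o3 (lorentz_bracket x (y :: 'k vec))
    = lorentz_to_o3 x * lorentz_to_o3 y - lorentz_to_o3 y * lorentz_to_o3 x"
  by (simp add: lorentz_to_o3_def o3_elem_bracket lorentz_bracket_index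
      minus_CHAR_2[OF char2] uminus_CHAR_2[OF char2] algebra_simps)

text \<open>Equivariance of \<iota>: it makes \<open>lorentz_ideal\<close> a copy of the adjoint
  module of \<open>o3\<close>, and minimality, commutativity and uniqueness all rest on it.\<close>

lemma lorentz_bracket_o3_to_lorentz:
  "lorentz_bracket x (o3_to_lorentz (o3_elem a b (c :: 'k)))
    = o3_to_lorentz (lorentz_to_o3 x * o3_elem a b c - o3_elem a b c * lorentz_to_o3 x)"
  by (rule vec6_eqI)
    (simp_all add: lorentz_to_o3_def o3_elem_bracket lorentz_bracket_index
      minus_CHAR_2[OF char2] uminus_CHAR_2[OF char2] algebra_simps)

lemma lorentz_to_o3_o3_to_lorentz:
  "lorentz_to_o3 (o3_to_lorentz (o3_elem a b (c :: 'k))) = o3_elem 0 0 0"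
  by (simp add: lorentz_to_o3_def double_eq_0)

text \<open>A sum of two coordinates vanishes in characteristic 2 exactly when they agree, and the
  resulting equal pairs are the pattern of \<iota>.\<close>

lemma lorentz_to_o3_eq_zero_iff:
  assumes "x \<in> carrier_vec 6"
  shows "lorentz_to_o3 (x :: 'k vec) = o3_elem 0 0 0 \<longleftrightarrow> x \<in> lorentz_ideal TYPE('k)"
proof
  assume "lorentz_to_o3 x = o3_elem 0 0 0"
  then have "x $ 3 = x $ 2" "x $ 4 = x $ 1" "x $ 5 = x $ 0"
    by (simp_all add: lorentz_to_o3_def add_eq_0_iff uminus_CHAR_2[OF char2])
  then have "x = o3_to_lorentz (o3_elem (x $ 2) (x $ 1) (x $ 0))"
    using assms by (intro vec6_eqI) simp_all
  then show "x \<in> lorentz_ideal TYPE('k)"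
    unfolding lorentz_ideal_def by (rule image_eqI) simp
qed (auto simp: lorentz_ideal_def lorentz_to_o3_o3_to_lorentz elim!: o3_cases)

lemma lie_epimorphism_lorentz_to_o3:
  "lie_epimorphism class_ring (lorentz_algebra TYPE('k)) (o3 TYPE('k)) lorentz_to_o3"
proof (intro lie_epimorphism.intro lie_algebra_lorentz lie_algebra_o3, unfold_locales)
  show "lorentz_to_o3 \<in> LinearCombinations.module_hom class_ring (lorentz_algebra TYPE('k)) (o3 TYPE('k))"
    by (auto simp: LinearCombinations.module_hom_def lorentz_to_o3_def o3_elem_add o3_elem_smult algebra_simps)
  \<comment> \<open>The span of \<open>b\<^sub>1\<close>, \<open>b\<^sub>2\<close>,
    \<open>b\<^sub>3\<close> already maps onto \<open>o3\<close>.\<close>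
  have "o3_elem a b c \<in> lorentz_to_o3 ` carrier_vec 6" for a b c :: 'k
    by (rule image_eqI[of _ _ "vec 6 ((!) [c, b, a, 0, 0, 0])"])
      (simp_all add: lorentz_to_o3_def )
  then show "lorentz_to_o3 ` carrier (lorentz_algebra TYPE('k)) = carrier (o3 TYPE('k))"
    by (auto simp: lorentz_to_o3_def elim!: o3_cases)
qed (simp add: lorentz_to_o3_bracket)

interpretation lorentz: lie_epimorphism class_ring "lorentz_algebra TYPE('k)" "o3 TYPE('k)" lorentz_to_o3
  by (rule lie_epimorphism_lorentz_to_o3)

lemma ker_lorentz_to_o3: "lorentz.ker = lorentz_ideal TYPE('k)"
proof -
  have "lorentz_ideal TYPE('k) \<subseteq> carrier_vec 6"
    by (auto simp: lorentz_ideal_def)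
  then show ?thesis
    using lorentz_to_o3_eq_zero_iff by (auto simp: lorentz.ker_def o3_elem_zero)
qed

lemma lorentz_ideal_ideal: "lie_ideal class_ring (lorentz_ideal TYPE('k)) (lorentz_algebra TYPE('k))"
  using lorentz.ker_ideal unfolding ker_lorentz_to_o3 .

lemma lorentz_ideal_nonzero: "lorentz_ideal TYPE('k) \<noteq> {0\<^sub>v 6}"
proof
  assume "lorentz_ideal TYPE('k) = {0\<^sub>v 6}"
  then have "o3_to_lorentz (o3_elem 1 0 (0 :: 'k)) = 0\<^sub>v 6"
    unfolding lorentz_ideal_def using o3_elem_mem by blast
  then have "o3_to_lorentz (o3_elem 1 0 (0 :: 'k)) $ 2 = 0" by simp
  then show False by simp
qed

text \<open>By equivariance of \<open>o3_to_lorentz\<close>, ideals of the Lorentz type algebra below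
  \<open>lorentz_ideal\<close> pull back to ideals of the simple algebra \<open>o3\<close>.\<close>

lemma lorentz_ideal_minimal:
  "minimal_lie_ideal class_ring (lorentz_ideal TYPE('k)) (lorentz_algebra TYPE('k))"
proof -
  let ?M = "o3 TYPE('k)"
  have "J = lorentz_ideal TYPE('k)"
    if J: "J \<subseteq> lorentz_ideal TYPE('k)" "lie_ideal class_ring J (lorentz_algebra TYPE('k))" "J \<noteq> {0\<^sub>v 6}" for J
  proof -
    define P where "P = {A \<in> carrier ?M. o3_to_lorentz A \<in> J}"
    have P: "A \<in> P \<longleftrightarrow> A \<in> carrier ?M \<and> o3_to_lorentz A \<in> J" for A
      by (simp add: P_def)
    have zero: "0\<^sub>v 6 \<in> J"
      and add: "\<And>x y. x \<in> J \<Longrightarrow> y \<in> J \<Longrightarrow> x + y \<in> J"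
      and smult: "\<And>a x. x \<in> J \<Longrightarrow> a \<cdot>\<^sub>v x \<in> J"
      and bracket: "\<And>x y. x \<in> carrier_vec 6 \<Longrightarrow> y \<in> J \<Longrightarrow> lorentz_bracket x y \<in> J"
      using J(2) unfolding lie_ideal_def LinearCombinations.submodule_def by auto
    have "A * B - B * A \<in> P" if A: "A \<in> carrier ?M" and B: "B \<in> P" for A B
    proof -
      \<comment> \<open>Since A has the form \<phi> x, equivariance turns the bracket with A on
        \<open>P\<close> into the bracket with x on J.\<close>
      have "A \<in> lorentz_to_o3 ` carrier_vec 6"
        using A lorentz.surj by simp
      then obtain x where x: "x \<in> carrier_vec 6" "A = lorentz_to_o3 x"
        by blast
      have BM: "B \<in> carrier ?M" using B by (simp add: P)
      then obtain a b c where abc: "B = o3_elem a b c" by (rule o3_cases)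
      have "o3_to_lorentz (A * B - B * A) \<in> J"
        using bracket[OF x(1), of "o3_to_lorentz B"] B
        unfolding abc by (simp add: P lorentz_bracket_o3_to_lorentz x(2))
      then show ?thesis
        using lorentz.cod.bracket_closed[OF A BM] by (simp add: P)
    qed
    moreover have "LinearCombinations.submodule class_ring P ?M"
    proof (rule LinearCombinations.submodule.intro)
      show "v \<oplus>\<^bsub>?M\<^esub> w \<in> P" if vw: "v \<in> P" "w \<in> P" for v w
      proof -
        have "v \<in> carrier ?M" "w \<in> carrier ?M" using vw by (auto simp: P)
        then obtain a b c a' b' c' where "v = o3_elem a b c" "w = o3_elem a' b' c'"
          unfolding carrier_o3 by blast
        moreover from this have "o3_to_lorentz (v + w) \<in> J"
          using vw add by (simp add: P o3_to_lorentz_add)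
        ultimately show ?thesis by (simp add: P o3_elem_add)
      qed
      show "k \<odot>\<^bsub>?M\<^esub> v \<in> P" if v: "v \<in> P" for k v
      proof -
        have "v \<in> carrier ?M" using v by (auto simp: P)
        then obtain a b c where "v = o3_elem a b c" by (rule o3_cases)
        moreover from this have "o3_to_lorentz (k \<cdot>\<^sub>m v) \<in> J"
          using v smult by (simp add: P o3_to_lorentz_smult)
        ultimately show ?thesis by (simp add: P o3_elem_smult)
      qed
      show "\<zero>\<^bsub>?M\<^esub> \<in> P" using zero by (simp add: P o3_elem_zero o3_to_lorentz_zero)
    qed (use lorentz.cod.module_axioms in \<open>auto simp: P\<close>)
    ultimately have "lie_ideal class_ring P ?M"
      unfolding lie_ideal_def by simp
    then have "P = {\<zero>\<^bsub>?M\<^esub>} \<or> P = carrier ?M"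
      using simple_o3 unfolding simple_lie_algebra_def by blast
    \<comment> \<open>As J lies in the image of \<iota>, it is recovered from \<open>P\<close>: a
      zero \<open>P\<close> would make J zero, and a full \<open>P\<close> makes J the whole of
      \<open>lorentz_ideal\<close>.\<close>
    moreover have "J = o3_to_lorentz ` P"
      using J(1) by (auto simp: lorentz_ideal_def P)
    ultimately show ?thesis
      using J(3) by (auto simp: lorentz_ideal_def o3_elem_zero o3_to_lorentz_zero)
  qed
  then show ?thesis
    unfolding minimal_lie_ideal_def minimal_def
    using lorentz_ideal_ideal lorentz_ideal_nonzero by auto
qed

text \<open>By equivariance [\<iota> A, \<iota> B] = \<iota> [\<phi> (\<iota> A), B], and \<phi>
  (\<iota> A) = 0. All generating brackets are therefore zero, and so is their span.\<close>

lemma lorentz_ideal_abelian: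
  "lie_product class_ring (lorentz_algebra TYPE('k)) (lorentz_ideal TYPE('k)) (lorentz_ideal TYPE('k)) = {0\<^sub>v 6}"
proof -
  let ?L = "lorentz_algebra TYPE('k)"
  let ?S = "{lie_bracket ?L x y |x y. x \<in> lorentz_ideal TYPE('k) \<and> y \<in> lorentz_ideal TYPE('k)}"
  have "lorentz_bracket x y = 0\<^sub>v 6" if "x \<in> lorentz_ideal TYPE('k)" "y \<in> lorentz_ideal TYPE('k)" for x y
    using that
    by (auto simp: lorentz_ideal_def lorentz_bracket_o3_to_lorentz lorentz_to_o3_o3_to_lorentz
        o3_elem_bracket o3_to_lorentz_zero elim!: o3_cases)
  then have set: "?S \<subseteq> {\<zero>\<^bsub>?L\<^esub>}"
    by auto
  have "LinearCombinations.submodule class_ring {\<zero>\<^bsub>?L\<^esub>} ?L"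
    using lorentz.dom.module_axioms unfolding LinearCombinations.submodule_def by (auto intro!: eq_vecI)
  then have "lorentz.dom.span ?S \<subseteq> {\<zero>\<^bsub>?L\<^esub>}"
    using set by (intro lorentz.dom.span_is_subset)
  moreover have "LinearCombinations.submodule class_ring (lorentz.dom.span ?S) ?L"
    using set by (intro lorentz.dom.span_is_submodule) auto
  then have "\<zero>\<^bsub>?L\<^esub> \<in> lorentz.dom.span ?S"
    by (rule LinearCombinations.submodule.zero_closed)
  ultimately show ?thesis
    unfolding lie_product_def by auto
qed

lemma dim_lorentz_ideal:
  "vectorspace.dim class_ring (lorentz_algebra TYPE('k) \<lparr>carrier := lorentz_ideal TYPE('k)\<rparr>) = 3"
proof -
  let ?I = "lorentz_algebra TYPE('k) \<lparr>carrier := lorentz_ideal TYPE('k)\<rparr>"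
  have "Module.module class_ring ?I"
    using lorentz_ideal_ideal unfolding lie_ideal_def
    by (intro lorentz.dom.submodule_is_module) blast
  then interpret vectorspace class_ring ?I
    by (intro vectorspace.intro class_field)
  \<comment> \<open>With this identity generation is the definition of \<open>lorentz_ideal\<close>,
    and independence is injectivity of \<iota>.\<close>
  have comb: "a \<cdot>\<^sub>v o3_to_lorentz (o3_elem 1 0 0)
      + (b \<cdot>\<^sub>v o3_to_lorentz (o3_elem 0 1 0) + c \<cdot>\<^sub>v o3_to_lorentz (o3_elem 0 0 1))
      = o3_to_lorentz (o3_elem a b c)" for a b c :: 'k
    by (rule vec6_eqI) simp_all
  show ?thesis
    by (rule dim_eq_threeI[of "o3_to_lorentz (o3_elem 1 0 0)" "o3_to_lorentz (o3_elem 0 1 0)"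
          "o3_to_lorentz (o3_elem 0 0 1)"])
      (auto simp: comb lorentz_ideal_def elim!: o3_cases simp flip: o3_to_lorentz_zero)
qed

text \<open>Two minimal ideals with nonzero intersection both equal that intersection, so the task
  is to find a nonzero common element.\<close>

lemma minimal_eq_lorentz_ideal:
  assumes J: "minimal_lie_ideal class_ring J (lorentz_algebra TYPE('k))"
  shows "J = lorentz_ideal TYPE('k)"
proof -
  let ?L = "lorentz_algebra TYPE('k)" and ?I = "lorentz_ideal TYPE('k)"
  have Jid: "lie_ideal class_ring J ?L" and J0: "J \<noteq> {0\<^sub>v 6}"
    and Jmin: "\<And>B. B \<subseteq> J \<Longrightarrow> lie_ideal class_ring B ?L \<Longrightarrow> B \<noteq> {0\<^sub>v 6} \<Longrightarrow> B = J"
    using J unfolding minimal_lie_ideal_def minimal_def by auto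
  have Imin: "\<And>B. B \<subseteq> ?I \<Longrightarrow> lie_ideal class_ring B ?L \<Longrightarrow> B \<noteq> {0\<^sub>v 6} \<Longrightarrow> B = ?I"
    using lorentz_ideal_minimal unfolding minimal_lie_ideal_def minimal_def by auto
  have "J \<inter> ?I \<noteq> {0\<^sub>v 6}"
  proof (cases "J \<subseteq> ?I")
    case True
    then show ?thesis using J0 by (simp add: Int_absorb2)
  next
    case False
    then obtain x where x: "x \<in> J" "x \<notin> ?I" by blast
    then have xL: "x \<in> carrier_vec 6" using lie_ideal_subset[OF Jid] by auto
    then have "lorentz_to_o3 x \<noteq> \<zero>\<^bsub>o3 TYPE('k)\<^esub>"
      using x(2) lorentz_to_o3_eq_zero_iff by (simp add: o3_elem_zero)
    then obtain A where A: "A \<in> carrier (o3 TYPE('k))"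
      "lorentz_to_o3 x * A - A * lorentz_to_o3 x \<noteq> 0\<^sub>m 3 3"
      using lorentz.cod.simple_centerless[OF simple_o3, of "lorentz_to_o3 x"]
      by (auto simp: lorentz_to_o3_def)
    then obtain a b c where abc: "A = o3_elem a b c" by (elim o3_cases)
    let ?y = "lorentz_bracket x (o3_to_lorentz A)"
    have y: "?y = o3_to_lorentz (lorentz_to_o3 x * A - A * lorentz_to_o3 x)"
      unfolding abc by (rule lorentz_bracket_o3_to_lorentz)
    have "?y \<in> ?I"
      using lorentz_ideal_ideal xL A(1) unfolding lie_ideal_def by (auto simp: lorentz_ideal_def)
    moreover have "?y \<in> J"
    proof -
      \<comment> \<open>An ideal absorbs brackets whose second argument lies in it, whereas x is the
        first argument of \<open>?y\<close>; antisymmetry exchanges the two.\<close>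
      have "?y = - 1 \<cdot>\<^sub>v lorentz_bracket (o3_to_lorentz A) x"
        using xL by (intro vec6_eqI) (simp_all add: lorentz_bracket_index algebra_simps)
      then show ?thesis
        using Jid x(1) unfolding lie_ideal_def LinearCombinations.submodule_def by auto
    qed
    moreover have "?y \<noteq> 0\<^sub>v 6"
    proof -
      obtain p q r where pqr: "lorentz_to_o3 x * A - A * lorentz_to_o3 x = o3_elem p q r"
        unfolding abc lorentz_to_o3_def o3_elem_bracket by blast
      show ?thesis
        using A(2) unfolding y pqr o3_elem_zero o3_to_lorentz_zero[symmetric] by simp
    qed
    ultimately show ?thesis by blast
  qed
  moreover have "lie_ideal class_ring (J \<inter> ?I) ?L"
    using Jid lorentz_ideal_ideal by (rule lie_ideal_inter)
  ultimately show ?thesis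
    using Imin[of "J \<inter> ?I"] Jmin[of "J \<inter> ?I"] by auto
qed

end

theorem proposition4:
  assumes "CHAR('k :: field) = 2"
  shows "\<not> simple_lie_algebra class_ring (lorentz_algebra TYPE('k))
    \<and> simple_lie_algebra class_ring (o3 TYPE('k))
    \<and> (\<exists>!I. lie_ideal class_ring I (lorentz_algebra TYPE('k))
          \<and> vectorspace.dim class_ring (lorentz_algebra TYPE('k) \<lparr>carrier := I\<rparr>) = 3
          \<and> minimal_lie_ideal class_ring I (lorentz_algebra TYPE('k))
          \<and> maximal_lie_ideal class_ring I (lorentz_algebra TYPE('k))
          \<and> lie_product class_ring (lorentz_algebra TYPE('k)) I I = {\<zero>\<^bsub>lorentz_algebra TYPE('k)\<^esub>}
          \<and> lie_isomorphic class_ring (lie_quotient (lorentz_algebra TYPE('k)) I) (o3 TYPE('k)))"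
proof (intro conjI ex1I[of _ "lorentz_ideal TYPE('k)"])
  interpret lorentz: lie_epimorphism class_ring "lorentz_algebra TYPE('k)" "o3 TYPE('k)" lorentz_to_o3
    using assms by (rule lie_epimorphism_lorentz_to_o3)
  note ker = ker_lorentz_to_o3[OF assms]
  show "simple_lie_algebra class_ring (o3 TYPE('k))"
    by (rule simple_o3)
  show max: "maximal_lie_ideal class_ring (lorentz_ideal TYPE('k)) (lorentz_algebra TYPE('k))"
    using lorentz.ker_maximal[OF simple_o3] unfolding ker .
  show "lie_isomorphic class_ring (lie_quotient (lorentz_algebra TYPE('k)) (lorentz_ideal TYPE('k))) (o3 TYPE('k))"
    using lorentz.quotient_ker_isomorphic unfolding ker .
  \<comment> \<open>\<open>lorentz_ideal\<close> is nonzero and, being maximal, proper.\<close>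
  show "\<not> simple_lie_algebra class_ring (lorentz_algebra TYPE('k))"
    using lorentz_ideal_ideal[OF assms] lorentz_ideal_nonzero[OF assms] max
    unfolding simple_lie_algebra_def maximal_lie_ideal_def maximal_def by auto
  show "lie_product class_ring (lorentz_algebra TYPE('k)) (lorentz_ideal TYPE('k)) (lorentz_ideal TYPE('k))
      = {\<zero>\<^bsub>lorentz_algebra TYPE('k)\<^esub>}"
    using lorentz_ideal_abelian[OF assms] by simp
\<comment> \<open>Uniqueness: any ideal with the listed properties is minimal, hence equal to
  \<open>lorentz_ideal\<close>.\<close>
qed (use assms in \<open>auto intro: lorentz_ideal_ideal dim_lorentz_ideal lorentz_ideal_minimal
    dest: minimal_eq_lorentz_ideal\<close>)

end
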